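(* Let $\mathcal{Y}=[0;1]$ and let the loss be the entropy loss $\ell(y,y')=y\log\left(\frac{y}{y'}\right)+(1-y)\log\left(\frac{1-y}{1-y'}\right)$. For any training set size $n\in\mathbb{N}^*$, positive integer $d$ and input space $\mathcal{X}$ containing at least $\lfloor\log_2(2d)\rfloor$ points, there exists a set $\mathcal{G}$ of $d$ prediction functions such that: for any estimator $\hat g$ there exists a probability distribution on the data space $\mathcal{X}\times[0;1]$ for which $$\mathbb{E}R(\hat g)-\min_{g\in\mathcal{G}}R(g)\ge e^{-1}(\log2)\left(1\wedge\frac{\lfloor\log_2|\mathcal{G}|\rfloor}{n+1}\right).$$
   Context: $\ell(y,y')=K(y,y')$ is the Kullback–Leibler divergence between Bernoulli distributions with respective parameters $y$ and $y'$ (usual conventions, value $+\infty$ allowed). Prediction functions are (measurable) functions $\mathcal{X}\to[0;1]$. For a distribution $P$ on $\mathcal{X}\times[0;1]$, $R(g)=\mathbb{E}_{(X,Y)\sim P}\ell[Y,g(X)]$. An estimator $\hat g$ maps a training set $Z_1^n\in(\mathcal{X}\times[0;1])^n$ to a prediction function $\hat g_{Z_1^n}$; $\mathbb{E}R(\hat g)=\mathbb{E}_{Z_1^n\sim P^{\otimes n}}R(\hat g_{Z_1^n})$. $\lfloor x\rfloor$ is the largest integer not exceeding $x$, $a\wedge b=\min(a,b)$, and $|\mathcal{G}|=d$ is the cardinality of $\mathcal{G}$. Measurability of the manipulated quantities is implicitly assumed. *)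

theory Defs
  imports "HOL-Probability.Probability"
begin

text \<open>
  The term a log(a/b) of the Kullback-Leibler divergence, with the usual conventions
  0 log(0/b) = 0 for all b, and a log(a/0) = \<infinity> for a > 0.
\<close>
definition kl_term :: "real \<Rightarrow> real \<Rightarrow> ereal" where
  "kl_term a b = (if a = 0 then 0 else if b = 0 then \<infinity> else ereal (a * ln (a / b)))"

definition entropy_loss :: "real \<Rightarrow> real \<Rightarrow> ereal" where
  "entropy_loss y y' = kl_term y y' + kl_term (1 - y) (1 - y')"

lemma kl_term_ge_diff:
  assumes "0 \<le> a" "0 \<le> b"
  shows "ereal (a - b) \<le> kl_term a b"
proof (cases "a = 0 \<or> b = 0")
  case True
  then show ?thesis using assms by (auto simp: kl_term_def)
next
  case False
  with assms have pos: "a > 0" "b > 0" by auto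
  have "ln (b / a) \<le> b / a - 1" using pos by (intro ln_le_minus_one) auto
  then have "a * ln (b / a) \<le> a * (b / a - 1)" using pos by (intro mult_left_mono) auto
  also have "\<dots> = b - a" using pos by (simp add: field_simps)
  finally have "a - b \<le> a * ln (a / b)" using pos by (simp add: ln_div algebra_simps)
  then show ?thesis using pos by (simp add: kl_term_def)
qed

text \<open>By the next lemma, the map \<open>e2ennreal\<close> used in the definition of the risk truncates nothing.\<close>
lemma entropy_loss_nonneg:
  assumes "y \<in> {0..1}" "y' \<in> {0..1}"
  shows "0 \<le> entropy_loss y y'"
proof -
  have "ereal (y - y') + ereal ((1 - y) - (1 - y')) \<le> entropy_loss y y'"
    unfolding entropy_loss_def using assms by (intro add_mono kl_term_ge_diff) auto
  then show ?thesis by (simp add: zero_ereal_def)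
qed

abbreviation unit_borel :: "real measure" where
  "unit_borel \<equiv> restrict_space borel {0..1}"

text \<open>
  Only the carrier and the sigma-algebra of \<open>M\<close> matter.  Prediction functions are normalised to
  \<open>undefined\<close> outside the input space, so that distinct elements differ on the input space
  and a set of them has the cardinality it has as a set of functions from the input space to [0;1].
\<close>
definition prediction_functions :: "'x measure \<Rightarrow> ('x \<Rightarrow> real) set" where
  "prediction_functions M = measurable M unit_borel \<inter> extensional (space M)"

abbreviation data_space :: "'x measure \<Rightarrow> ('x \<times> real) measure" where
  "data_space M \<equiv> M \<Otimes>\<^sub>M unit_borel"

definition data_distributions :: "'x measure \<Rightarrow> ('x \<times> real) measure set" where
  "data_distributions M = {P. prob_space P \<and> sets P = sets (data_space M)}"

definition risk :: "('x \<times> real) measure \<Rightarrow> ('x \<Rightarrow> real) \<Rightarrow> ennreal" where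
  "risk P g = (\<integral>\<^sup>+ (x, y). e2ennreal (entropy_loss y (g x)) \<partial>P)"

text \<open>
  A training set is a function on \<open>{1..n}\<close>.  The measurability clause is exactly what is needed
  for the expected risk below to make sense for every data distribution.
\<close>
definition estimators ::
  "'x measure \<Rightarrow> nat \<Rightarrow> ((nat \<Rightarrow> 'x \<times> real) \<Rightarrow> 'x \<Rightarrow> real) set" where
  "estimators M n = {ghat.
     (\<forall>z \<in> space (Pi\<^sub>M {1..n} (\<lambda>_. data_space M)). ghat z \<in> prediction_functions M) \<and>
     (\<forall>P \<in> data_distributions M.
        (\<lambda>z. risk P (ghat z)) \<in> borel_measurable (Pi\<^sub>M {1..n} (\<lambda>_. data_space M)))}"

definition expected_risk ::
  "nat \<Rightarrow> ('x \<times> real) measure \<Rightarrow> ((nat \<Rightarrow> 'x \<times> real) \<Rightarrow> 'x \<Rightarrow> real) \<Rightarrow> ennreal" where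
  "expected_risk n P ghat = (\<integral>\<^sup>+ z. risk P (ghat z) \<partial>(Pi\<^sub>M {1..n} (\<lambda>_. P)))"

end

theory Submission
  imports Defs
begin

text \<open>
  Take points \<open>t 0, \<dots>, t m\<close> with \<open>m = \<lfloor>log 2 d\<rfloor>\<close>, let \<open>G\<close> contain the \<open>2 ^ m\<close> functions that
  label \<open>t 0, \<dots>, t (m - 1)\<close> by 0 or 1 and vanish at \<open>t m\<close>, and put \<open>k = min m (n + 1)\<close>. The input is drawn with
  mass \<open>1 / (n + 1)\<close> on each of \<open>t 0, \<dots>, t (k - 1)\<close> and the remaining mass on \<open>t m\<close>; the label is a
  deterministic 0/1 function of the input which vanishes at \<open>t m\<close>, so the best function has risk 0.
  With probability \<open>(n / (n + 1)) ^ n \<ge> exp (-1)\<close> a given \<open>t i\<close> is absent from the sample. Averaging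
  over its two possible labels, every prediction there costs at least \<open>ln 2\<close>. Hence the expected
  risk, averaged over the \<open>2 ^ k\<close> labellings, is at least \<open>k / (n + 1) * exp (-1) * ln 2\<close>.
\<close>

section \<open>Entropy loss at the labels 0 and 1\<close>

lemma entropy_loss_0: "p \<in> {0..1} \<Longrightarrow> entropy_loss 0 p = (if p = 1 then \<infinity> else ereal (- ln (1 - p)))"
  by (auto simp: entropy_loss_def kl_term_def ln_div)

lemma entropy_loss_1: "p \<in> {0..1} \<Longrightarrow> entropy_loss 1 p = (if p = 0 then \<infinity> else ereal (- ln p))"
  by (auto simp: entropy_loss_def kl_term_def ln_div)

text \<open>The sum of the two losses is \<open>- ln (p * (1 - p))\<close>, and
  \<open>p * (1 - p)\<close> is at most 1/4; at \<open>p = 0\<close> and \<open>p = 1\<close> one of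
  the losses is infinite. Thus a prediction made without knowledge of the label costs at least
  \<open>ln 2\<close> on average.\<close>

lemma entropy_loss_0_plus_1_ge:
  assumes "p \<in> {0..1}"
  shows "ennreal (2 * ln 2) \<le> e2ennreal (entropy_loss 0 p) + e2ennreal (entropy_loss 1 p)"
proof (cases "p = 0 \<or> p = 1")
  case True
  then show ?thesis by (auto simp: entropy_loss_0 entropy_loss_1)
next
  case False
  with assms have p: "0 < p" "p < 1" by auto
  have "4 * (p * (1 - p)) \<le> 1"
    using zero_le_power2[of "2 * p - 1"] by (simp add: power2_eq_square algebra_simps)
  then have "ln (4 * (p * (1 - p))) \<le> 0" using p by simp
  moreover have "ln (4 * (p * (1 - p))) = ln (2 ^ 2) + ln p + ln (1 - p)"
    using p by (simp add: ln_mult)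
  moreover have "ln (2 ^ 2 :: real) = 2 * ln 2"
    by (subst ln_realpow) auto
  ultimately have "2 * ln 2 \<le> - ln (1 - p) + - ln p" by simp
  moreover have "- ln (1 - p) \<ge> 0" "- ln p \<ge> 0" using p by auto
  ultimately show ?thesis
    using False assms
    by (auto simp: entropy_loss_0 entropy_loss_1 simp flip: ennreal_plus intro!: ennreal_leI)
qed

lemma entropy_loss_refl: "y \<in> {0, 1} \<Longrightarrow> entropy_loss y y = 0"
  by (auto simp: entropy_loss_def kl_term_def)

lemma measurable_entropy_loss [measurable (raw)]:
  fixes f g :: "'a \<Rightarrow> real"
  assumes [measurable]: "f \<in> borel_measurable N" "g \<in> borel_measurable N"
  shows "(\<lambda>x. entropy_loss (f x) (g x)) \<in> borel_measurable N"
  unfolding entropy_loss_def kl_term_def by measurable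

section \<open>Membership in the set of prediction functions\<close>

lemma prediction_functionsD:
  assumes "g \<in> prediction_functions M"
  shows "g \<in> borel_measurable M" "x \<in> space M \<Longrightarrow> g x \<in> {0..1}"
  using assms
  by (auto simp: prediction_functions_def measurable_restrict_space2_iff space_restrict_space)

lemma prediction_functionsI:
  assumes "g \<in> borel_measurable M" "\<And>x. x \<in> space M \<Longrightarrow> g x \<in> {0..1}"
  shows "restrict g (space M) \<in> prediction_functions M"
proof -
  have "restrict g (space M) \<in> measurable M unit_borel"
    using assms measurable_cong[of M "restrict g (space M)" g unit_borel]
    by (auto intro!: measurable_restrict_space2)
  then show ?thesis by (simp add: prediction_functions_def)
qed

section \<open>Hard distributions and their risks as finite sums\<close>

text \<open>Labels are attached to indices; they depend on the point alone when indices with the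
  same point are all in \<open>S\<close> or all outside.\<close>

definition labelled :: "(nat \<Rightarrow> 'x) \<Rightarrow> nat set \<Rightarrow> nat \<Rightarrow> 'x \<times> real" where
  "labelled t S i = (t i, of_bool (i \<in> S))"

text \<open>The randomness is a uniform index among n + 1. Where \<open>t\<close> repeats a point
  the masses add up, which is how one point can receive all the remaining mass.\<close>

definition cube_distribution :: "'x measure \<Rightarrow> nat \<Rightarrow> (nat \<Rightarrow> 'x) \<Rightarrow> nat set \<Rightarrow> ('x \<times> real) measure" where
  "cube_distribution M n t S = distr (measure_pmf (pmf_of_set {..n})) (data_space M) (labelled t S)"

lemma labelled_in_space: "t i \<in> space M \<Longrightarrow> labelled t S i \<in> space (data_space M)"
  by (simp add: labelled_def space_pair_measure space_restrict_space)

lemma cube_distribution_in_data_distributions: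
  assumes "\<And>i. t i \<in> space M"
  shows "cube_distribution M n t S \<in> data_distributions M"
  using assms
  by (auto simp: cube_distribution_def data_distributions_def labelled_in_space
      intro!: measure_pmf.prob_space_distr)

lemma risk_cube_distribution:
  assumes t: "\<And>i. t i \<in> space M" and g: "g \<in> prediction_functions M"
  shows "risk (cube_distribution M n t S) g
    = (\<Sum>i\<le>n. e2ennreal (entropy_loss (of_bool (i \<in> S)) (g (t i)))) / of_nat (Suc n)"
proof -
  note [measurable] = prediction_functionsD(1)[OF g]
  have [measurable]: "snd \<in> borel_measurable (data_space M)"
    by (rule measurable_compose[OF measurable_snd]) (simp add: measurable_restrict_space1)
  have "(\<lambda>(x, y). e2ennreal (entropy_loss y (g x))) \<in> borel_measurable (data_space M)"
    unfolding case_prod_beta by measurable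
  then show ?thesis
    unfolding risk_def cube_distribution_def
    by (subst nn_integral_distr)
       (auto simp: t nn_integral_pmf_of_set labelled_def space_pair_measure space_restrict_space)
qed

text \<open>Independent uniform indices form a uniform element of a finite set of maps, and
  labelling acts coordinatewise. This turns expectations over samples into finite sums.\<close>

lemma PiM_cube_distribution:
  fixes m :: nat
  assumes t: "\<And>i. t i \<in> space M"
  shows "Pi\<^sub>M {1..m} (\<lambda>_. cube_distribution M n t S)
    = distr (measure_pmf (pmf_of_set ({1..m} \<rightarrow>\<^sub>E {..n}))) (Pi\<^sub>M {1..m} (\<lambda>_. data_space M))
        (\<lambda>u. \<lambda>j\<in>{1..m}. labelled t S (u j))"
    (is "_ = distr (measure_pmf (pmf_of_set ?U)) ?N ?h")
proof -
  interpret product_sigma_finite "\<lambda>_. cube_distribution M n t S"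
    using cube_distribution_in_data_distributions[of t M n S, OF t]
    by (simp add: product_sigma_finite_def data_distributions_def prob_space_imp_sigma_finite)
  have meas: "?h \<in> measurable (measure_pmf (pmf_of_set ?U)) ?N"
    using labelled_in_space[of t, OF t] by (auto simp: space_PiM)
  have U: "finite ?U" "?U \<noteq> {}" "card ?U = Suc n ^ m"
    by (auto simp: card_PiE PiE_eq_empty_iff intro!: finite_PiE)
  have sets: "sets (distr (measure_pmf (pmf_of_set ?U)) ?N ?h)
      = sets (Pi\<^sub>M {1..m} (\<lambda>_. cube_distribution M n t S))"
    by (auto simp: cube_distribution_def intro!: sets_PiM_cong)
  have "emeasure (distr (measure_pmf (pmf_of_set ?U)) ?N ?h) (Pi\<^sub>E {1..m} A)
      = (\<Prod>i\<in>{1..m}. emeasure (cube_distribution M n t S) (A i))"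
    if "\<And>i. i \<in> {1..m} \<Longrightarrow> A i \<in> sets (cube_distribution M n t S)" for A
  proof -
    from that have A: "\<And>i. i \<in> {1..m} \<Longrightarrow> A i \<in> sets (data_space M)"
      by (simp add: cube_distribution_def)
    have 1: "emeasure (cube_distribution M n t S) (A i)
        = ennreal (real (card {j\<in>{..n}. labelled t S j \<in> A i}) / real (Suc n))" if "i \<in> {1..m}" for i
      unfolding cube_distribution_def using that A
      by (subst emeasure_distr)
         (auto simp: labelled_in_space t measure_pmf.emeasure_eq_measure measure_pmf_of_set
            intro!: arg_cong[where f = card])
    \<comment> \<open>The preimage of a box is a box of index sets, so its cardinality
      factorises.\<close>
    have "?U \<inter> ?h -` Pi\<^sub>E {1..m} A = (\<Pi>\<^sub>E i\<in>{1..m}. {j\<in>{..n}. labelled t S j \<in> A i})"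
      by (auto simp: PiE_iff)
    then have "emeasure (distr (measure_pmf (pmf_of_set ?U)) ?N ?h) (Pi\<^sub>E {1..m} A)
        = ennreal ((\<Prod>i\<in>{1..m}. real (card {j\<in>{..n}. labelled t S j \<in> A i})) / real (Suc n) ^ m)"
      using A meas U
      by (subst emeasure_distr)
         (auto simp: measure_pmf.emeasure_eq_measure measure_pmf_of_set card_PiE intro!: sets_PiM_I_finite)
    also have "\<dots> = (\<Prod>i\<in>{1..m}. emeasure (cube_distribution M n t S) (A i))"
      by (simp add: 1 prod_ennreal prod_dividef)
    finally show ?thesis .
  qed
  then show ?thesis using sets by (intro PiM_eqI[symmetric]) auto
qed

text \<open>The n sample indices and the test index each contribute one factor \<open>Suc n\<close>
  to the denominator.\<close>

lemma expected_risk_cube_distribution: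
  assumes t: "\<And>i. t i \<in> space M" and ghat: "ghat \<in> estimators M n"
  shows "expected_risk n (cube_distribution M n t S) ghat
    = (\<Sum>u\<in>{1..n} \<rightarrow>\<^sub>E {..n}. \<Sum>i\<le>n. e2ennreal (entropy_loss (of_bool (i \<in> S))
        (ghat (\<lambda>j\<in>{1..n}. labelled t S (u j)) (t i)))) / of_nat (Suc n ^ Suc n)"
    (is "_ = (\<Sum>u\<in>?U. \<Sum>i\<le>n. ?L u i) / _")
proof -
  let ?h = "\<lambda>u. \<lambda>j\<in>{1..n}. labelled t S (u j)"
  have sp: "?h u \<in> space (Pi\<^sub>M {1..n} (\<lambda>_. data_space M))" for u
    using labelled_in_space[of t, OF t] by (auto simp: space_PiM)
  have U: "finite ?U" "?U \<noteq> {}" "card ?U = Suc n ^ n"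
    by (auto simp: card_PiE PiE_eq_empty_iff intro!: finite_PiE)
  have "expected_risk n (cube_distribution M n t S) ghat
      = (\<integral>\<^sup>+ u. risk (cube_distribution M n t S) (ghat (?h u)) \<partial>measure_pmf (pmf_of_set ?U))"
    unfolding expected_risk_def PiM_cube_distribution[of t M, OF t]
    using ghat cube_distribution_in_data_distributions[of t M n S, OF t] sp
    by (subst nn_integral_distr) (auto simp: estimators_def)
  also have "\<dots> = (\<Sum>u\<in>?U. risk (cube_distribution M n t S) (ghat (?h u))) / of_nat (Suc n ^ n)"
    using U by (subst nn_integral_pmf_of_set) auto
  also have "\<dots> = (\<Sum>u\<in>?U. (\<Sum>i\<le>n. ?L u i) / of_nat (Suc n)) / of_nat (Suc n ^ n)"
    using ghat sp by (subst risk_cube_distribution[of t M, OF t]) (auto simp: estimators_def)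
  also have "\<dots> = (\<Sum>u\<in>?U. \<Sum>i\<le>n. ?L u i) / of_nat (Suc n ^ Suc n)"
  proof -
    have "inverse (of_nat (Suc n)) * inverse (of_nat (Suc n ^ n))
        = (inverse (of_nat (Suc n ^ Suc n)) :: ennreal)"
      by (simp only: power_Suc of_nat_mult ennreal_inverse_mult of_nat_less_top)
    then show ?thesis
      by (simp add: divide_ennreal_def mult.assoc del: of_nat_Suc of_nat_power power_Suc
          flip: sum_distrib_right)
  qed
  finally show ?thesis .
qed

section \<open>Averaging over the labellings\<close>

text \<open>The subsets of \<open>K\<close> split into \<open>2 ^ (card K - 1)\<close> pairs
  \<open>S\<close>, \<open>insert i S\<close>, and each pair contributes at least
  \<open>2 * c\<close>.\<close>

lemma sum_Pow_ge:
  fixes f :: "'a set \<Rightarrow> ennreal"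
  assumes "finite K" "i \<in> K"
    and "\<And>S. S \<subseteq> K - {i} \<Longrightarrow> ennreal (2 * c) \<le> f S + f (insert i S)"
    and "c \<ge> 0"
  shows "ennreal (2 ^ card K * c) \<le> (\<Sum>S\<in>Pow K. f S)"
proof -
  let ?J = "K - {i}"
  have K: "K = insert i ?J" using assms by auto
  have "Pow K = Pow ?J \<union> insert i ` Pow ?J" by (subst K, rule Pow_insert)
  then have "(\<Sum>S\<in>Pow K. f S) = (\<Sum>S\<in>Pow ?J. f S) + (\<Sum>S\<in>insert i ` Pow ?J. f S)"
    using assms by (auto intro!: sum.union_disjoint)
  also have "(\<Sum>S\<in>insert i ` Pow ?J. f S) = (\<Sum>S\<in>Pow ?J. f (insert i S))"
    by (subst sum.reindex) (auto simp: inj_on_def)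
  also have "(\<Sum>S\<in>Pow ?J. f S) + (\<Sum>S\<in>Pow ?J. f (insert i S)) = (\<Sum>S\<in>Pow ?J. f S + f (insert i S))"
    by (simp add: sum.distrib)
  also have "\<dots> \<ge> (\<Sum>S\<in>Pow ?J. ennreal (2 * c))"
    using assms by (intro sum_mono) auto
  also have "(\<Sum>S\<in>Pow ?J. ennreal (2 * c)) = ennreal (\<Sum>S\<in>Pow ?J. 2 * c)"
    using assms by (intro sum_ennreal) simp
  also have "(\<Sum>S\<in>Pow ?J. 2 * c) = 2 ^ card ?J * (2 * c)"
    using assms by (simp add: card_Pow)
  also have "2 ^ card ?J * (2 * c) = 2 ^ card K * c"
    using card.remove[OF assms(1,2)] by simp
  finally show ?thesis .
qed

lemma exists_ge_average:
  fixes f :: "'a \<Rightarrow> ennreal"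
  assumes "finite A" "A \<noteq> {}" and "ennreal (real (card A) * c) \<le> (\<Sum>a\<in>A. f a)"
  shows "\<exists>a\<in>A. ennreal c \<le> f a"
proof (rule ccontr)
  assume "\<not> ?thesis"
  \<comment> \<open>Values below \<open>ennreal c\<close> are finite, so the strict inequalities can
    be summed in the reals.\<close>
  then have less: "f a < ennreal c" if "a \<in> A" for a using that by (auto simp: not_le)
  then have fin: "f a = ennreal (enn2real (f a))" if "a \<in> A" for a
    using that by (metis ennreal_enn2real ennreal_less_top less_trans)
  have "enn2real (f a) < c" if "a \<in> A" for a
    using less[OF that] fin[OF that] enn2real_nonneg[of "f a"]
    by (metis ennreal_less_iff)
  then have "(\<Sum>a\<in>A. enn2real (f a)) < (\<Sum>a\<in>A. c)"
    using assms by (intro sum_strict_mono) auto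
  moreover have "(\<Sum>a\<in>A. f a) = ennreal (\<Sum>a\<in>A. enn2real (f a))"
    using fin by (subst sum_ennreal[symmetric]) auto
  ultimately show False
    using assms(3) by (simp add: ennreal_le_iff2 sum_nonneg not_le)
      (smt (verit, best) enn2real_nonneg sum_nonneg)
qed

text \<open>This inverts the bound of \<open>(1 + 1 / n) ^ n\<close> by e. The power is the
  probability that n uniform draws from n + 1 indices all avoid a given one.\<close>

lemma exp_minus_1_le_power: "exp (-1) \<le> (real n / real (Suc n)) ^ n"
proof (cases "n = 0")
  case False
  have "(1 + 1 / real n) ^ n \<le> exp 1"
    using False exp_ge_one_plus_x_over_n_power_n[of n 1] by simp
  then have "inverse (exp 1) \<le> inverse ((1 + 1 / real n) ^ n)"
    using False by (intro le_imp_inverse_le zero_less_power) (auto intro: add_pos_nonneg)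
  also have "\<dots> = (real n / real (Suc n)) ^ n"
    using False by (simp add: field_simps flip: power_inverse)
  finally show ?thesis by (simp add: exp_minus)
qed simp

lemma exists_cube_distribution_expected_risk_ge:
  assumes t: "\<And>i. t i \<in> space M" and ghat: "ghat \<in> estimators M n" and k: "k \<le> Suc n"
  shows "\<exists>S\<subseteq>{..<k}. ennreal (exp (-1) * ln 2 * (real k / real (Suc n)))
           \<le> expected_risk n (cube_distribution M n t S) ghat"
proof -
  define L where "L S u i = e2ennreal (entropy_loss (of_bool (i \<in> S))
        (ghat (\<lambda>j\<in>{1..n}. labelled t S (u j)) (t i)))" for S u i
  let ?U = "{1..n} \<rightarrow>\<^sub>E {..n}"
  let ?V = "\<lambda>i. {1..n} \<rightarrow>\<^sub>E ({..n} - {i})"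
  let ?N = "Suc n ^ Suc n"
  \<comment> \<open>There are k indices of mass 1 / (n + 1); each is missed by the sample with
    probability \<open>(n / (n + 1)) ^ n\<close> and then costs \<open>ln 2\<close> on
    average.\<close>
  define c where "c = (real n / real (Suc n)) ^ n * ln 2 * (real k / real (Suc n))"
  have pair: "ennreal (2 * ln 2) \<le> L S u i + L (insert i S) u i"
    if "S \<subseteq> {..<k} - {i}" "u \<in> ?V i" for S u i
  proof -
    let ?z = "\<lambda>j\<in>{1..n}. labelled t S (u j)"
    \<comment> \<open>Since \<open>u\<close> avoids \<open>i\<close>, the training set does not
      reveal whether \<open>i\<close> is in \<open>S\<close>, and the estimator returns the same
      function for both labellings.\<close>
    have same: "(\<lambda>j\<in>{1..n}. labelled t (insert i S) (u j)) = ?z"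
      using that by (auto simp: labelled_def fun_eq_iff PiE_iff)
    have "?z \<in> space (Pi\<^sub>M {1..n} (\<lambda>_. data_space M))"
      using labelled_in_space[of t, OF t] by (auto simp: space_PiM)
    then have "ghat ?z \<in> prediction_functions M"
      using ghat by (auto simp: estimators_def)
    then have "ghat ?z (t i) \<in> {0..1}" by (rule prediction_functionsD) (rule t)
    from entropy_loss_0_plus_1_ge[OF this]
    have "ennreal (2 * ln 2) \<le> e2ennreal (entropy_loss (of_bool (i \<in> S)) (ghat ?z (t i)))
        + e2ennreal (entropy_loss (of_bool (i \<in> insert i S)) (ghat ?z (t i)))"
      using that by auto
    then show ?thesis by (simp only: L_def same)
  qed
  \<comment> \<open>Each \<open>i < k\<close> is avoided by exactly \<open>n ^ n\<close> samples, as
    \<open>k \<le> Suc n\<close> puts \<open>i\<close> in \<open>{..n}\<close>.\<close>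
  have "2 ^ k * real k * real n ^ n * ln 2 = (\<Sum>i<k. \<Sum>u\<in>?V i. 2 ^ k * ln 2)"
    using k by (simp add: card_PiE mult_ac)
  then have "ennreal (2 ^ k * real k * real n ^ n * ln 2) = ennreal (\<Sum>i<k. \<Sum>u\<in>?V i. 2 ^ k * ln 2)"
    by (rule arg_cong)
  also have "\<dots> = (\<Sum>i<k. ennreal (\<Sum>u\<in>?V i. 2 ^ k * ln 2))"
    by (rule sum_ennreal[symmetric]) (intro sum_nonneg mult_nonneg_nonneg; simp)
  also have "\<dots> = (\<Sum>i<k. \<Sum>u\<in>?V i. ennreal (2 ^ k * ln 2))"
    by (intro sum.cong refl sum_ennreal[symmetric] mult_nonneg_nonneg) simp_all
  also have "\<dots> \<le> (\<Sum>i<k. \<Sum>u\<in>?V i. \<Sum>S\<in>Pow {..<k}. L S u i)"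
    using pair sum_Pow_ge[of "{..<k}" _ "ln 2"] by (intro sum_mono) auto
  \<comment> \<open>This step restores the samples that hit \<open>i\<close>, the next one the
    indices from k to n; both only add nonnegative losses.\<close>
  also have "\<dots> \<le> (\<Sum>i<k. \<Sum>u\<in>?U. \<Sum>S\<in>Pow {..<k}. L S u i)"
    by (intro sum_mono sum_mono2 finite_PiE PiE_mono) auto
  also have "\<dots> \<le> (\<Sum>i\<le>n. \<Sum>u\<in>?U. \<Sum>S\<in>Pow {..<k}. L S u i)"
    using k by (intro sum_mono2) auto
  also have "\<dots> = (\<Sum>u\<in>?U. \<Sum>i\<le>n. \<Sum>S\<in>Pow {..<k}. L S u i)"
    by (rule sum.swap)
  also have "\<dots> = (\<Sum>u\<in>?U. \<Sum>S\<in>Pow {..<k}. \<Sum>i\<le>n. L S u i)"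
    by (intro sum.cong refl sum.swap)
  also have "\<dots> = (\<Sum>S\<in>Pow {..<k}. \<Sum>u\<in>?U. \<Sum>i\<le>n. L S u i)"
    by (rule sum.swap)
  finally have "ennreal (2 ^ k * real k * real n ^ n * ln 2) / of_nat ?N
      \<le> (\<Sum>S\<in>Pow {..<k}. \<Sum>u\<in>?U. \<Sum>i\<le>n. L S u i) / of_nat ?N"
    by (rule divide_right_mono_ennreal)
  also have "ennreal (2 ^ k * real k * real n ^ n * ln 2) / of_nat ?N
      = ennreal (2 ^ k * real k * real n ^ n * ln 2 / real ?N)"
    unfolding ennreal_of_nat_eq_real_of_nat by (rule divide_ennreal) (auto simp del: power_Suc)
  also have "2 ^ k * real k * real n ^ n * ln 2 / real ?N = real (card (Pow {..<k})) * c"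
    by (simp add: c_def card_Pow power_divide field_simps del: of_nat_Suc mult_Suc)
  also have "(\<Sum>S\<in>Pow {..<k}. \<Sum>u\<in>?U. \<Sum>i\<le>n. L S u i) / of_nat ?N
      = (\<Sum>S\<in>Pow {..<k}. expected_risk n (cube_distribution M n t S) ghat)"
    by (simp add: expected_risk_cube_distribution[of t M, OF t ghat] L_def divide_ennreal_def
        sum_distrib_right)
  finally have "\<exists>S\<in>Pow {..<k}. ennreal c \<le> expected_risk n (cube_distribution M n t S) ghat"
    by (intro exists_ge_average) auto
  then obtain S where S: "S \<subseteq> {..<k}"
      "ennreal c \<le> expected_risk n (cube_distribution M n t S) ghat"
    by auto
  have "exp (-1) * ln 2 * (real k / real (Suc n)) \<le> c"
    unfolding c_def by (intro mult_right_mono exp_minus_1_le_power) auto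
  with S show ?thesis by (meson ennreal_leI order_trans)
qed

section \<open>Isolating points by measurable sets and enlarging the class\<close>

text \<open>Point separation does not make singletons measurable, but intersecting the finitely many
  sets that separate \<open>x\<close> from the other points of \<open>T\<close> isolates
  \<open>x\<close> within \<open>T\<close>.\<close>

lemma finite_separating_sets:
  assumes separating: "\<And>x x'. x \<in> space M \<Longrightarrow> x' \<in> space M \<Longrightarrow> x \<noteq> x' \<Longrightarrow>
           \<exists>A \<in> sets M. x \<in> A \<and> x' \<notin> A"
    and T: "finite T" "T \<subseteq> space M"
  obtains A where "\<And>x. x \<in> T \<Longrightarrow> A x \<in> sets M" "\<And>x. x \<in> T \<Longrightarrow> A x \<inter> T = {x}"
proof -
  have "\<exists>B\<in>sets M. B \<inter> T = {x}" if "x \<in> T" for x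
  proof -
    have "\<forall>x'\<in>T - {x}. \<exists>A\<in>sets M. x \<in> A \<and> x' \<notin> A"
      using separating[of x] that T by (metis DiffE insertCI subsetD)
    then obtain C where C: "\<And>x'. x' \<in> T - {x} \<Longrightarrow> C x' \<in> sets M \<and> x \<in> C x' \<and> x' \<notin> C x'"
      by metis
    \<comment> \<open>For \<open>T = {x}\<close> the intersection is \<open>UNIV\<close>; the factor
      \<open>space M\<close> keeps \<open>?B\<close> measurable.\<close>
    let ?B = "space M \<inter> (\<Inter>x'\<in>T - {x}. C x')"
    have "?B = space M - (\<Union>x'\<in>T - {x}. space M - C x')" by auto
    also have "\<dots> \<in> sets M" using C T by (intro sets.Diff sets.finite_UN) auto
    finally have "?B \<in> sets M" .
    moreover have "?B \<inter> T = {x}" using C T that by auto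
    ultimately show ?thesis by blast
  qed
  then show ?thesis using that by metis
qed

text \<open>The constants in [0, 1] are pairwise distinct prediction functions. They leave room to
  enlarge a finite class to any prescribed size.\<close>

lemma infinite_prediction_functions:
  assumes "space M \<noteq> {}"
  shows "infinite (prediction_functions M)"
proof
  assume "finite (prediction_functions M)"
  moreover have "(\<lambda>c. restrict (\<lambda>_. c) (space M)) ` {0..1} \<subseteq> prediction_functions M"
    by (auto intro!: prediction_functionsI)
  moreover have "inj_on (\<lambda>c::real. restrict (\<lambda>_. c) (space M)) {0..1}"
    using assms by (auto simp: inj_on_def fun_eq_iff restrict_def)
  ultimately have "finite {0..1::real}"
    by (meson finite_imageD finite_subset)
  then show False using infinite_Icc[of "0::real" 1] by simp
qed

lemma exists_superset_with_card:
  assumes "infinite B" "finite A" "A \<subseteq> B" "card A \<le> d"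
  obtains C where "A \<subseteq> C" "C \<subseteq> B" "finite C" "card C = d"
proof -
  obtain D where D: "D \<subseteq> B - A" "finite D" "card D = d - card A"
    using infinite_arbitrarily_large[of "B - A" "d - card A"] assms by auto
  then have "card (A \<union> D) = d"
    using assms by (subst card_Un_disjoint) auto
  with D assms show ?thesis by (intro that[of "A \<union> D"]) auto
qed

section \<open>The class and the lower bound\<close>

theorem theorem8p7:
  fixes M :: "'x measure" and n d :: nat
  assumes "n \<ge> 1" and "d \<ge> 1"
    and separating: "\<And>x x'. x \<in> space M \<Longrightarrow> x' \<in> space M \<Longrightarrow> x \<noteq> x' \<Longrightarrow>
           \<exists>A \<in> sets M. x \<in> A \<and> x' \<notin> A"
    and enough_points: "\<exists>S \<subseteq> space M. finite S \<and> int (card S) \<ge> \<lfloor>log 2 (2 * real d)\<rfloor>"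
  shows "\<exists>G \<subseteq> prediction_functions M. finite G \<and> card G = d \<and>
           (\<forall>ghat \<in> estimators M n. \<exists>P \<in> data_distributions M.
              (MIN g\<in>G. risk P g) < \<infinity> \<and>
              enn2ereal (expected_risk n P ghat) - enn2ereal (MIN g\<in>G. risk P g)
                \<ge> ereal (exp (-1) * ln 2 *
                     min 1 (real_of_int \<lfloor>log 2 (real (card G))\<rfloor> / (real n + 1))))"
proof -
  define m where "m = nat \<lfloor>log 2 (real d)\<rfloor>"
  define k where "k = min m (Suc n)"
  have m: "\<lfloor>log 2 (real d)\<rfloor> = int m"
    using \<open>d \<ge> 1\<close> by (simp add: m_def zero_le_log_cancel_iff)
  have "2 powr real m \<le> 2 powr log 2 (real d)"
    using m by (intro powr_mono) linarith+
  then have "real (2 ^ m) \<le> real d"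
    using \<open>d \<ge> 1\<close> by (simp add: powr_realpow)
  then have d: "2 ^ m \<le> d" by (simp only: of_nat_le_iff)
  have "log 2 (2 * real d) = log 2 (real d) + 1"
    using \<open>d \<ge> 1\<close> by (simp add: log_mult)
  \<comment> \<open>The hypothesis thus supplies m + 1 points: m with free labels, and
    \<open>t m\<close>, whose label is always 0.\<close>
  then have "\<lfloor>log 2 (2 * real d)\<rfloor> = int (Suc m)" using m by simp
  then obtain T0 where "T0 \<subseteq> space M" "Suc m \<le> card T0" using enough_points by auto
  then obtain T where T: "T \<subseteq> space M" "card T = Suc m" "finite T"
    by (metis obtain_subset_with_card_n order_trans)
  obtain t where t: "bij_betw t {..<Suc m} T"
    using ex_bij_betw_nat_finite[OF \<open>finite T\<close>] T(2) by (auto simp: atLeast0LessThan)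
  have tT: "t i \<in> T" if "i \<le> m" for i
    using t that by (auto simp: bij_betw_def)
  have t_eq: "t i = t j \<longleftrightarrow> i = j" if "i \<le> m" "j \<le> m" for i j
    using t that by (auto simp: bij_betw_def inj_on_def)
  obtain A where A: "\<And>x. x \<in> T \<Longrightarrow> A x \<in> sets M" "\<And>x. x \<in> T \<Longrightarrow> A x \<inter> T = {x}"
    using finite_separating_sets[OF separating \<open>finite T\<close> \<open>T \<subseteq> space M\<close>] by blast
  \<comment> \<open>The sets \<open>A (t j)\<close> stand in for singletons to ensure measurability;
    the risks below see \<open>g S\<close> only on \<open>T\<close>.\<close>
  define g where "g S = restrict (indicator (\<Union>j\<in>S. A (t j)) :: 'x \<Rightarrow> real) (space M)" for S
  have g_t: "g S (t i) = of_bool (i \<in> S)" if "S \<subseteq> {..<m}" "i \<le> m" for S i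
  proof -
    have "t i \<in> A (t j) \<longleftrightarrow> i = j" if "j \<in> S" for j
    proof -
      have "j \<le> m" using that \<open>S \<subseteq> {..<m}\<close> by auto
      then show ?thesis using A(2)[OF tT[of j]] tT[of i] t_eq[of i j] \<open>i \<le> m\<close> by blast
    qed
    then show ?thesis using tT[OF \<open>i \<le> m\<close>] T(1) by (auto simp: g_def indicator_def)
  qed
  have g_pred: "g S \<in> prediction_functions M" if "S \<subseteq> {..<m}" for S
  proof -
    have "(\<Union>j\<in>S. A (t j)) \<in> sets M"
      using that A(1)[OF tT] by (intro sets.finite_UN) (auto intro: finite_subset)
    then show ?thesis unfolding g_def
      by (intro prediction_functionsI) (auto simp: indicator_def)
  qed
  \<comment> \<open>As \<open>d\<close> may exceed \<open>2 ^ m\<close>, the class is filled up with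
    arbitrary prediction functions; these cannot bring the minimal risk below 0, which some
    \<open>g S\<close> attains.\<close>
  have "card (g ` Pow {..<m}) \<le> d"
    using card_image_le[of "Pow {..<m}" g] d by (simp add: card_Pow)
  moreover have "space M \<noteq> {}" using T by auto
  ultimately obtain G where G: "g ` Pow {..<m} \<subseteq> G" "G \<subseteq> prediction_functions M" "finite G" "card G = d"
    using exists_superset_with_card[OF infinite_prediction_functions, of M "g ` Pow {..<m}" d] g_pred
    by blast
  \<comment> \<open>The n + 1 - k indices from \<open>k\<close> on all name \<open>t m\<close>. They
    carry label 0, because \<open>S\<close> will lie in \<open>{..<k}\<close>.\<close>
  define \<tau> where "\<tau> i = t (if i < k then i else m)" for i
  have \<tau>: "\<tau> i \<in> space M" for i
    using tT T(1) by (auto simp: \<tau>_def k_def)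
  have main: "\<exists>P \<in> data_distributions M. (MIN g\<in>G. risk P g) < \<infinity> \<and>
      enn2ereal (expected_risk n P ghat) - enn2ereal (MIN g\<in>G. risk P g)
        \<ge> ereal (exp (-1) * ln 2 * min 1 (real_of_int \<lfloor>log 2 (real (card G))\<rfloor> / (real n + 1)))"
    if ghat: "ghat \<in> estimators M n" for ghat
  proof -
    obtain S where S: "S \<subseteq> {..<k}"
      "ennreal (exp (-1) * ln 2 * (real k / real (Suc n)))
         \<le> expected_risk n (cube_distribution M n \<tau> S) ghat"
      using exists_cube_distribution_expected_risk_ge[of \<tau> M, OF \<tau> ghat, of k]
      by (auto simp: k_def)
    have Sm: "S \<subseteq> {..<m}" using S by (auto simp: k_def)
    \<comment> \<open>The labelling is itself in the class: for \<open>i \<ge> k\<close> both sides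
      are 0, since \<open>m\<close> is not in \<open>S\<close>.\<close>
    have "g S (\<tau> i) = of_bool (i \<in> S)" for i
      using g_t[OF Sm] S(1) Sm by (auto simp: \<tau>_def k_def)
    then have "risk (cube_distribution M n \<tau> S) (g S) = 0"
      by (simp add: risk_cube_distribution[of \<tau> M, OF \<tau> g_pred[OF Sm]] entropy_loss_refl)
    then have min0: "(MIN g\<in>G. risk (cube_distribution M n \<tau> S) g) = 0"
      using G Sm by (intro Min_eqI) (auto simp: image_iff intro!: bexI[of _ "g S"])
    have "ereal (exp (-1) * ln 2 * (real k / real (Suc n)))
        \<le> enn2ereal (expected_risk n (cube_distribution M n \<tau> S) ghat)"
      using S(2) by (simp add: less_eq_ennreal.rep_eq ennreal.rep_eq)
    \<comment> \<open>The cap of \<open>k\<close> at n + 1, where masses 1 / (n + 1) exhaust the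
      total, produces the minimum with 1.\<close>
    moreover have "real k / real (Suc n) = min 1 (real_of_int \<lfloor>log 2 (real (card G))\<rfloor> / (real n + 1))"
      unfolding G(4) m k_def by (cases "m \<le> n") (auto simp: min_def)
    ultimately have "ereal (exp (-1) * ln 2 * min 1 (real_of_int \<lfloor>log 2 (real (card G))\<rfloor> / (real n + 1)))
        \<le> enn2ereal (expected_risk n (cube_distribution M n \<tau> S) ghat)"
      by (simp only:)
    then show ?thesis
      using cube_distribution_in_data_distributions[of \<tau> M n S, OF \<tau>]
      by (intro bexI[of _ "cube_distribution M n \<tau> S"]) (auto simp: min0 zero_ennreal.rep_eq)
  qed
  with G show ?thesis by blast
qed

end
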